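(* Let $$L_j=A_{j,0}+\sum_{i=1}^nX_iA_{j,i},\qquad j=1,2,$$ be linear pencils of sizes $m_1$ and $m_2$ respectively, with $0\neq A_{1,0}\succeq0$, and assume that the spectrahedron $S_{L_1}$ is bounded. Let $\tau:\mathscr{S}_1\to\mathscr{S}_2$ be the linear map determined by $\tau(A_{1,i})=A_{2,i}$ for $i=0,\dots,n$. Then: (1) for every $d\in\mathbb{N}$, $\tau$ is $d$-positive if and only if $\mathfrak{S}_{L_1}(d)\subseteq\mathfrak{S}_{L_2}(d)$; (2) $\tau$ is completely positive if and only if $\mathfrak{S}_{L_1}\subseteq\mathfrak{S}_{L_2}$.
   Context: A linear pencil of size $m$ in the variables $X_1,\dots,X_n$ is $L=A_0+\sum_{i=1}^nX_iA_i$ with real symmetric $m\times m$ matrices $A_i$. $A\succeq0$ means real symmetric positive semidefinite. $S_L=\{x\in\mathbb{R}^n\mid L(x)\succeq0\}$. For an $n$-tuple $Z=(Z_1,\dots,Z_n)$ of real symmetric $d\times d$ matrices, $L(Z)=I_d\otimes A_0+\sum_{i=1}^nZ_i\otimes A_i$, a real symmetric $dm\times dm$ matrix. $\mathfrak{S}_L(d)$ is the set of $n$-tuples $Z$ of real symmetric $d\times d$ matrices with $L(Z)\succeq0$, and $\mathfrak{S}_L=\bigcup_{d\in\mathbb{N}}\mathfrak{S}_L(d)$ is the matricial spectrahedron of $L$. $\mathscr{S}_j$ is the real linear span of $A_{j,0},\dots,A_{j,n}$ inside the real symmetric $m_j\times m_j$ matrices. (Since $0\ne A_{1,0}\succeq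 0$ and $S_{L_1}$ is bounded, $A_{1,0},\dots,A_{1,n}$ are linearly independent, so $\tau$ is well defined.) For a linear map $\varphi:\mathscr{S}_1\to\mathscr{S}_2$ and $d\in\mathbb{N}$, the ampliation $\varphi_d:\mathscr{S}_1^{d\times d}=\mathbb{R}^{d\times d}\otimes\mathscr{S}_1\to\mathscr{S}_2^{d\times d}$ applies $\varphi$ to each block, i.e. $M\otimes A\mapsto M\otimes\varphi(A)$; elements of $\mathscr{S}_j^{d\times d}$ are regarded as $dm_j\times dm_j$ real matrices. $\varphi$ is $d$-positive if $\varphi_d$ maps (symmetric) positive semidefinite matrices to positive semidefinite matrices, and completely positive if it is $d$-positive for every $d\in\mathbb{N}$. *)

theory Defs
  imports Complex_Main "Jordan_Normal_Form.VS_Connect"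
begin

definition symmetric_mats :: "nat \<Rightarrow> real mat set" where
  "symmetric_mats m = {A \<in> carrier_mat m m. transpose_mat A = A}"

definition psd :: "real mat \<Rightarrow> bool" where
  "psd A \<longleftrightarrow> A \<in> symmetric_mats (dim_row A) \<and>
     (\<forall>v \<in> carrier_vec (dim_row A). v \<bullet> (A *\<^sub>v v) \<ge> 0)"

definition kronecker :: "real mat \<Rightarrow> real mat \<Rightarrow> real mat" where
  "kronecker A B = mat (dim_row A * dim_row B) (dim_col A * dim_col B)
     (\<lambda>(i, j). A $$ (i div dim_row B, j div dim_col B) * B $$ (i mod dim_row B, j mod dim_col B))"

text \<open>A pencil of size \<open>m\<close> in \<open>n\<close> variables is given by its coefficients \<open>A 0, \<dots>, A n\<close>.
  Tuples are indexed from \<open>0\<close>, so that their entry \<open>i\<close> belongs to the coefficient \<open>A (Suc i)\<close>.\<close>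

definition linear_pencil :: "nat \<Rightarrow> nat \<Rightarrow> (nat \<Rightarrow> real mat) \<Rightarrow> bool" where
  "linear_pencil n m A \<longleftrightarrow> (\<forall>i \<le> n. A i \<in> symmetric_mats m)"

definition pencil_eval :: "nat \<Rightarrow> nat \<Rightarrow> (nat \<Rightarrow> real mat) \<Rightarrow> real vec \<Rightarrow> real mat" where
  "pencil_eval n m A x =
     A 0 + finsum (module_mat TYPE(real) m m) (\<lambda>i. (x $ i) \<cdot>\<^sub>m A (Suc i)) {..<n}"

definition pencil_eval_mat ::
    "nat \<Rightarrow> nat \<Rightarrow> (nat \<Rightarrow> real mat) \<Rightarrow> nat \<Rightarrow> real mat list \<Rightarrow> real mat" where
  "pencil_eval_mat n m A d Z =
     kronecker (1\<^sub>m d) (A 0) +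
     finsum (module_mat TYPE(real) (d * m) (d * m)) (\<lambda>i. kronecker (Z ! i) (A (Suc i))) {..<n}"

definition spectrahedron :: "nat \<Rightarrow> nat \<Rightarrow> (nat \<Rightarrow> real mat) \<Rightarrow> real vec set" where
  "spectrahedron n m A = {x \<in> carrier_vec n. psd (pencil_eval n m A x)}"

text \<open>The type \<^typ>\<open>real vec\<close> carries no metric, so boundedness for the Euclidean norm is spelled out.\<close>

definition bounded_vecs :: "real vec set \<Rightarrow> bool" where
  "bounded_vecs S \<longleftrightarrow> (\<exists>B. \<forall>x \<in> S. sqrt (x \<bullet> x) \<le> B)"

definition matricial_spectrahedron_at ::
    "nat \<Rightarrow> nat \<Rightarrow> (nat \<Rightarrow> real mat) \<Rightarrow> nat \<Rightarrow> real mat list set" where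
  "matricial_spectrahedron_at n m A d =
     {Z. length Z = n \<and> set Z \<subseteq> symmetric_mats d \<and> psd (pencil_eval_mat n m A d Z)}"

text \<open>Matrix sizes \<open>d\<close> start at \<open>1\<close>. At size \<open>0\<close> every condition is void,
  and for \<open>n = 0\<close> it would put the empty tuple into the union for every pencil.\<close>

definition matricial_spectrahedron ::
    "nat \<Rightarrow> nat \<Rightarrow> (nat \<Rightarrow> real mat) \<Rightarrow> real mat list set" where
  "matricial_spectrahedron n m A = (\<Union>d \<in> {1..}. matricial_spectrahedron_at n m A d)"

definition coeff_span :: "nat \<Rightarrow> nat \<Rightarrow> (nat \<Rightarrow> real mat) \<Rightarrow> real mat set" where
  "coeff_span n m A =
     LinearCombinations.module.span class_ring (module_mat TYPE(real) m m) (A ` {..n})"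

text \<open>Linear maps between subspaces \<open>S\<^sub>1\<close>, \<open>S\<^sub>2\<close> of the spaces of square matrices of
  sizes \<open>m\<^sub>1\<close>, \<open>m\<^sub>2\<close>; nothing is said about the values outside \<open>S\<^sub>1\<close>.\<close>

definition linear_on_mats ::
    "nat \<Rightarrow> real mat set \<Rightarrow> nat \<Rightarrow> real mat set \<Rightarrow> (real mat \<Rightarrow> real mat) \<Rightarrow> bool" where
  "linear_on_mats m\<^sub>1 S\<^sub>1 m\<^sub>2 S\<^sub>2 \<phi> \<longleftrightarrow>
     linear_map class_ring
       ((module_mat TYPE(real) m\<^sub>1 m\<^sub>1)\<lparr>carrier := S\<^sub>1\<rparr>)
       ((module_mat TYPE(real) m\<^sub>2 m\<^sub>2)\<lparr>carrier := S\<^sub>2\<rparr>) \<phi>"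

definition mat_block :: "nat \<Rightarrow> real mat \<Rightarrow> nat \<Rightarrow> nat \<Rightarrow> real mat" where
  "mat_block m Y p q = mat m m (\<lambda>(i, j). Y $$ (p * m + i, q * m + j))"

text \<open>The space \<open>S\<^bsup>d\<times>d\<^esup>\<close>, for \<open>S\<close> consisting of matrices of size \<open>m\<close>.
  The block layout is the one of \<^const>\<open>kronecker\<close>: \<open>M \<otimes> A\<close> has the blocks \<open>M\<^bsub>pq\<^esub> A\<close>.\<close>

definition block_mats :: "nat \<Rightarrow> nat \<Rightarrow> real mat set \<Rightarrow> real mat set" where
  "block_mats d m S =
     {Y \<in> carrier_mat (d * m) (d * m). \<forall>p < d. \<forall>q < d. mat_block m Y p q \<in> S}"

definition ampliation ::
    "nat \<Rightarrow> nat \<Rightarrow> nat \<Rightarrow> (real mat \<Rightarrow> real mat) \<Rightarrow> real mat \<Rightarrow> real mat" where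
  "ampliation d m\<^sub>1 m\<^sub>2 \<phi> Y = mat (d * m\<^sub>2) (d * m\<^sub>2)
     (\<lambda>(i, j). \<phi> (mat_block m\<^sub>1 Y (i div m\<^sub>2) (j div m\<^sub>2)) $$ (i mod m\<^sub>2, j mod m\<^sub>2))"

definition d_positive ::
    "nat \<Rightarrow> nat \<Rightarrow> real mat set \<Rightarrow> nat \<Rightarrow> (real mat \<Rightarrow> real mat) \<Rightarrow> bool" where
  "d_positive d m\<^sub>1 S\<^sub>1 m\<^sub>2 \<phi> \<longleftrightarrow>
     (\<forall>Y \<in> block_mats d m\<^sub>1 S\<^sub>1. psd Y \<longrightarrow> psd (ampliation d m\<^sub>1 m\<^sub>2 \<phi> Y))"

definition completely_positive ::
    "nat \<Rightarrow> real mat set \<Rightarrow> nat \<Rightarrow> (real mat \<Rightarrow> real mat) \<Rightarrow> bool" where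
  "completely_positive m\<^sub>1 S\<^sub>1 m\<^sub>2 \<phi> \<longleftrightarrow> (\<forall>d \<ge> 1. d_positive d m\<^sub>1 S\<^sub>1 m\<^sub>2 \<phi>)"

end

theory Submission
  imports Defs
begin

text \<open>
  Write \<open>\<Sum>\<^sub>i X\<^sub>i \<otimes> A\<^sub>i\<close> (\<open>0 \<le> i \<le> n\<close>) for a matrix with blocks in the span of the \<open>A\<^sub>i = A\<^bsub>1,i\<^esub>\<close>. The
  ampliation of \<open>\<tau>\<close> sends it to \<open>\<Sum>\<^sub>i X\<^sub>i \<otimes> A\<^bsub>2,i\<^esub>\<close>, and the value of a pencil at a tuple \<open>Z\<close> is the case
  \<open>X\<^sub>0 = I\<close>, \<open>X\<^sub>i = Z\<^sub>i\<close>. Hence a \<open>d\<close>-positive \<open>\<tau>\<close> maps positive values \<open>L\<^sub>1(Z)\<close> to positive values \<open>L\<^sub>2(Z)\<close>,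
  which is the inclusion of the matricial spectrahedra at size \<open>d\<close>.

  Conversely, a positive semidefinite \<open>Y = \<Sum>\<^sub>i X\<^sub>i \<otimes> A\<^sub>i\<close> has to be brought to the shape \<open>X\<^sub>0 = I\<close>. Here the
  boundedness of the spectrahedron enters: a positive semidefinite combination \<open>\<Sum>\<^sub>i c\<^sub>i A\<^sub>i\<close> has
  \<open>c\<^sub>0 \<ge> 0\<close>, since otherwise \<open>(c\<^sub>1, \<dots>, c\<^sub>n)\<close> would span an unbounded ray in the spectrahedron or \<open>A\<^sub>0\<close>
  would vanish (\<open>constant_coeff_nonneg\<close>). This gives the linear independence of the \<open>A\<^sub>i\<close>, hence the
  symmetry of the \<open>X\<^sub>i\<close>, and, tested on elementary tensors \<open>v \<otimes> w\<close>, that \<open>X\<^sub>0\<close> is positive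
  semidefinite. If \<open>X\<^sub>0\<close> is definite, some invertible \<open>P\<close> has \<open>P\<^sup>T X\<^sub>0 P = I\<close>, and the tuple of the
  \<open>P\<^sup>T X\<^sub>i P\<close> belongs to the first matricial spectrahedron, thus to the second; undoing the congruence
  shows that the ampliation of \<open>Y\<close> is positive semidefinite (\<open>psd_transfer_of_pos_def\<close>). In general
  \<open>Y\<close> is replaced by \<open>Y + \<epsilon> I \<otimes> A\<^sub>0\<close>, and \<open>\<epsilon>\<close> tends to \<open>0\<close> (\<open>psd_transfer\<close>).

  Complete positivity is \<open>d\<close>-positivity for all \<open>d\<close>, so the second equivalence follows from the first
  once the inclusion of the unions is seen to be the inclusion at every size.
\<close>

section \<open>Quadratic forms of linear and tensor combinations\<close>

definition quad_form :: "nat \<Rightarrow> real mat \<Rightarrow> (nat \<Rightarrow> real) \<Rightarrow> real" where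
  "quad_form m M u = (\<Sum>a<m. \<Sum>b<m. u a * M $$ (a, b) * u b)"

definition trace_pairing :: "nat \<Rightarrow> real mat \<Rightarrow> real mat \<Rightarrow> real" where
  "trace_pairing m A B = (\<Sum>a<m. \<Sum>b<m. A $$ (a, b) * B $$ (a, b))"

definition lin_comb :: "nat \<Rightarrow> nat \<Rightarrow> (nat \<Rightarrow> real) \<Rightarrow> (nat \<Rightarrow> real mat) \<Rightarrow> real mat" where
  "lin_comb n m c A = mat m m (\<lambda>(a, b). \<Sum>i\<le>n. c i * A i $$ (a, b))"

text \<open>\<open>tensor_comb\<close> is the sum of the Kronecker products \<open>X i \<otimes> A i\<close>. It is written entrywise, so that
  evaluations of pencils, elements of the block space over the coefficient span, and their
  ampliations all take this one shape.\<close>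

definition tensor_comb ::
    "nat \<Rightarrow> nat \<Rightarrow> nat \<Rightarrow> (nat \<Rightarrow> real mat) \<Rightarrow> (nat \<Rightarrow> real mat) \<Rightarrow> real mat" where
  "tensor_comb n d m X A = mat (d * m) (d * m)
     (\<lambda>(r, s). \<Sum>i\<le>n. X i $$ (r div m, s div m) * A i $$ (r mod m, s mod m))"

lemma linear_pencilD: "linear_pencil n m A \<Longrightarrow> i \<le> n \<Longrightarrow> A i \<in> symmetric_mats m"
  by (simp add: linear_pencil_def)

lemma symmetric_mats_carrier: "A \<in> symmetric_mats m \<Longrightarrow> A \<in> carrier_mat m m"
  by (simp add: symmetric_mats_def)

lemma linear_pencil_carrier: "linear_pencil n m A \<Longrightarrow> i \<le> n \<Longrightarrow> A i \<in> carrier_mat m m"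
  by (simp add: linear_pencil_def symmetric_mats_carrier)

lemma symmetric_mats_iff_entries:
  assumes "A \<in> carrier_mat m m"
  shows "A \<in> symmetric_mats m \<longleftrightarrow> (\<forall>a<m. \<forall>b<m. A $$ (a, b) = A $$ (b, a))"
proof
  assume "A \<in> symmetric_mats m"
  then have "transpose_mat A = A" by (simp add: symmetric_mats_def)
  then show "\<forall>a<m. \<forall>b<m. A $$ (a, b) = A $$ (b, a)"
    using assms by (metis carrier_matD index_transpose_mat(1))
next
  assume "\<forall>a<m. \<forall>b<m. A $$ (a, b) = A $$ (b, a)"
  then have "transpose_mat A = A" using assms by (intro eq_matI) auto
  then show "A \<in> symmetric_mats m" using assms by (simp add: symmetric_mats_def)
qed

lemma symmetric_mats_sym:
  assumes "A \<in> symmetric_mats m" "a < m" "b < m"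
  shows "A $$ (a, b) = A $$ (b, a)"
  using assms symmetric_mats_iff_entries symmetric_mats_carrier by blast

lemma scalar_prod_mult_mat_vec:
  assumes "M \<in> carrier_mat m m" "v \<in> carrier_vec m"
  shows "v \<bullet> (M *\<^sub>v v) = quad_form m M (\<lambda>a. v $ a)"
  using assms unfolding quad_form_def scalar_prod_def mult_mat_vec_def
  by (auto simp: sum_distrib_left atLeast0LessThan mult.assoc intro!: sum.cong)

lemma psd_iff_quad_form:
  assumes M: "M \<in> carrier_mat m m"
  shows "psd M \<longleftrightarrow> M \<in> symmetric_mats m \<and> (\<forall>u. 0 \<le> quad_form m M u)"
proof -
  have "(\<forall>v\<in>carrier_vec m. 0 \<le> v \<bullet> (M *\<^sub>v v)) \<longleftrightarrow> (\<forall>u. 0 \<le> quad_form m M u)"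
  proof safe
    fix u assume *: "\<forall>v\<in>carrier_vec m. 0 \<le> v \<bullet> (M *\<^sub>v v)"
    have "vec m u \<bullet> (M *\<^sub>v vec m u) = quad_form m M u"
      by (subst scalar_prod_mult_mat_vec[OF M]) (auto simp: quad_form_def)
    then show "0 \<le> quad_form m M u" using * by (metis vec_carrier)
  qed (simp add: scalar_prod_mult_mat_vec[OF M])
  then show ?thesis using M by (simp add: psd_def)
qed

lemma quad_form_lin_comb:
  "quad_form m (lin_comb n m c A) w = (\<Sum>i\<le>n. c i * quad_form m (A i) w)"
proof -
  have "quad_form m (lin_comb n m c A) w =
      (\<Sum>a<m. \<Sum>b<m. \<Sum>i\<le>n. c i * (w a * A i $$ (a, b) * w b))"
    by (simp add: quad_form_def lin_comb_def sum_distrib_left sum_distrib_right mult.assoc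
        mult.left_commute)
  also have "\<dots> = (\<Sum>i\<le>n. \<Sum>a<m. \<Sum>b<m. c i * (w a * A i $$ (a, b) * w b))"
    by (subst sum.swap[of _ "{..n}"], subst (2) sum.swap) (rule refl)
  finally show ?thesis by (simp add: quad_form_def sum_distrib_left)
qed

lemma lin_comb_carrier [simp]: "lin_comb n m c A \<in> carrier_mat m m"
  by (simp add: lin_comb_def)

lemma lin_comb_symmetric:
  assumes "linear_pencil n m A"
  shows "lin_comb n m c A \<in> symmetric_mats m"
  using symmetric_mats_sym[OF linear_pencilD[OF assms]]
  by (auto simp: symmetric_mats_iff_entries lin_comb_def intro!: sum.cong)

lemma tensor_comb_carrier [simp]: "tensor_comb n d m X A \<in> carrier_mat (d * m) (d * m)"
  by (simp add: tensor_comb_def)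

lemma div_mod_block_less:
  assumes "r < d * (m::nat)"
  shows "r div m < d" "r mod m < m"
proof -
  have "0 < m" using assms by (cases m) auto
  then show "r div m < d" "r mod m < m"
    using assms by (simp_all add: less_mult_imp_div_less)
qed

lemma block_index_less:
  assumes "p < d" "a < (m::nat)"
  shows "p * m + a < d * m"
proof -
  have "p * m + a < Suc p * m" using assms by simp
  also have "\<dots> \<le> d * m" using assms by (intro mult_le_mono1) simp
  finally show ?thesis .
qed

lemma tensor_comb_entry:
  assumes "p < d" "q < d" "a < m" "b < m"
  shows "tensor_comb n d m X A $$ (p * m + a, q * m + b) = (\<Sum>i\<le>n. X i $$ (p, q) * A i $$ (a, b))"
  using assms by (simp add: tensor_comb_def block_index_less)

lemma tensor_comb_symmetric:
  assumes "linear_pencil n d X" "linear_pencil n m A"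
  shows "tensor_comb n d m X A \<in> symmetric_mats (d * m)"
  using symmetric_mats_sym[OF linear_pencilD[OF assms(1)]]
    symmetric_mats_sym[OF linear_pencilD[OF assms(2)]]
  by (auto simp: symmetric_mats_iff_entries tensor_comb_def div_mod_block_less intro!: sum.cong)

lemma sum_over_blocks: "(\<Sum>r<d * m. f r) = (\<Sum>p<d. \<Sum>a<m. f (p * m + a))"
  for f :: "nat \<Rightarrow> real"
proof -
  have "(\<Sum>a<m. f (p * m + a)) = sum f {p * m..<p * m + m}" for p
    using sum.shift_bounds_nat_ivl[of f 0 "p * m" m]
    by (simp add: atLeast0LessThan add.commute)
  then show ?thesis by (simp add: sum.nat_group)
qed

text \<open>The block vector whose \<open>p\<close>-th block is row \<open>p\<close> of \<open>U\<close> turns the quadratic form of \<open>X \<otimes> A\<close>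
  into the pairing of \<open>A\<close> with \<open>U\<^sup>T X U\<close>. In this form a congruence of \<open>X\<close> is just a substitution for
  \<open>U\<close>, and no products of Kronecker matrices are needed.\<close>

lemma trace_pairing_congruence:
  assumes X: "X \<in> carrier_mat d d" and U: "U \<in> carrier_mat d m"
  shows "trace_pairing m A (transpose_mat U * X * U) =
    (\<Sum>p<d. \<Sum>a<m. \<Sum>q<d. \<Sum>b<m. U $$ (p, a) * (X $$ (p, q) * A $$ (a, b)) * U $$ (q, b))"
proof -
  have "(transpose_mat U * X * U) $$ (a, b) = (\<Sum>q<d. \<Sum>p<d. U $$ (p, a) * X $$ (p, q) * U $$ (q, b))"
    if "a < m" "b < m" for a b
    using that X U
    by (subst sum.swap) (simp add: scalar_prod_def atLeast0LessThan sum_distrib_left mult.assoc)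
  then have "trace_pairing m A (transpose_mat U * X * U) =
    (\<Sum>a<m. \<Sum>b<m. \<Sum>q<d. \<Sum>p<d. U $$ (p, a) * (X $$ (p, q) * A $$ (a, b)) * U $$ (q, b))"
    by (simp add: trace_pairing_def sum_distrib_left mult_ac)
  also have "\<dots> = (\<Sum>a<m. \<Sum>q<d. \<Sum>b<m. \<Sum>p<d. U $$ (p, a) * (X $$ (p, q) * A $$ (a, b)) * U $$ (q, b))"
    by (subst (2) sum.swap) (rule refl)
  also have "\<dots> = (\<Sum>a<m. \<Sum>q<d. \<Sum>p<d. \<Sum>b<m. U $$ (p, a) * (X $$ (p, q) * A $$ (a, b)) * U $$ (q, b))"
    by (subst (3) sum.swap) (rule refl)
  also have "\<dots> = (\<Sum>a<m. \<Sum>p<d. \<Sum>q<d. \<Sum>b<m. U $$ (p, a) * (X $$ (p, q) * A $$ (a, b)) * U $$ (q, b))"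
    by (subst (2) sum.swap) (rule refl)
  also have "\<dots> = (\<Sum>p<d. \<Sum>a<m. \<Sum>q<d. \<Sum>b<m. U $$ (p, a) * (X $$ (p, q) * A $$ (a, b)) * U $$ (q, b))"
    by (rule sum.swap)
  finally show ?thesis .
qed

lemma quad_form_tensor_comb:
  assumes X: "linear_pencil n d X" and U: "U \<in> carrier_mat d m"
    and u: "\<And>p a. p < d \<Longrightarrow> a < m \<Longrightarrow> u (p * m + a) = U $$ (p, a)"
  shows "quad_form (d * m) (tensor_comb n d m X A) u =
    (\<Sum>i\<le>n. trace_pairing m (A i) (transpose_mat U * X i * U))"
proof -
  let ?t = "\<lambda>i p a q b. U $$ (p, a) * (X i $$ (p, q) * A i $$ (a, b)) * U $$ (q, b)"
  have "quad_form (d * m) (tensor_comb n d m X A) u =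
      (\<Sum>p<d. \<Sum>a<m. \<Sum>q<d. \<Sum>b<m. \<Sum>i\<le>n. ?t i p a q b)"
    unfolding quad_form_def sum_over_blocks
    by (simp add: u tensor_comb_entry sum_distrib_left sum_distrib_right)
  also have "\<dots> = (\<Sum>p<d. \<Sum>a<m. \<Sum>q<d. \<Sum>i\<le>n. \<Sum>b<m. ?t i p a q b)"
    by (subst (4) sum.swap) (rule refl)
  also have "\<dots> = (\<Sum>p<d. \<Sum>a<m. \<Sum>i\<le>n. \<Sum>q<d. \<Sum>b<m. ?t i p a q b)"
    by (subst (3) sum.swap) (rule refl)
  also have "\<dots> = (\<Sum>p<d. \<Sum>i\<le>n. \<Sum>a<m. \<Sum>q<d. \<Sum>b<m. ?t i p a q b)"
    by (subst (2) sum.swap) (rule refl)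
  also have "\<dots> = (\<Sum>i\<le>n. \<Sum>p<d. \<Sum>a<m. \<Sum>q<d. \<Sum>b<m. ?t i p a q b)"
    by (rule sum.swap)
  also have "\<dots> = (\<Sum>i\<le>n. trace_pairing m (A i) (transpose_mat U * X i * U))"
    by (intro sum.cong refl trace_pairing_congruence[symmetric]
        linear_pencil_carrier[OF X] U) simp
  finally show ?thesis .
qed

lemma psd_tensor_comb_iff:
  assumes X: "linear_pencil n d X"
    and A: "linear_pencil n m A"
  shows "psd (tensor_comb n d m X A) \<longleftrightarrow>
    (\<forall>U\<in>carrier_mat d m. 0 \<le> (\<Sum>i\<le>n. trace_pairing m (A i) (transpose_mat U * X i * U)))"
proof -
  note form = quad_form_tensor_comb[OF X]
  have "psd (tensor_comb n d m X A) \<longleftrightarrow> (\<forall>u. 0 \<le> quad_form (d * m) (tensor_comb n d m X A) u)"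
    using psd_iff_quad_form[OF tensor_comb_carrier] tensor_comb_symmetric[OF X A] by blast
  also have "\<dots> \<longleftrightarrow>
    (\<forall>U\<in>carrier_mat d m. 0 \<le> (\<Sum>i\<le>n. trace_pairing m (A i) (transpose_mat U * X i * U)))"
  proof safe
    fix U :: "real mat"
    assume *: "\<forall>u. 0 \<le> quad_form (d * m) (tensor_comb n d m X A) u" and U: "U \<in> carrier_mat d m"
    show "0 \<le> (\<Sum>i\<le>n. trace_pairing m (A i) (transpose_mat U * X i * U))"
      using *[rule_format, of "\<lambda>k. U $$ (k div m, k mod m)"] form[OF U] by simp
  next
    fix u :: "nat \<Rightarrow> real"
    assume *: "\<forall>U\<in>carrier_mat d m. 0 \<le> (\<Sum>i\<le>n. trace_pairing m (A i) (transpose_mat U * X i * U))"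
    show "0 \<le> quad_form (d * m) (tensor_comb n d m X A) u"
      using * form[where U = "mat d m (\<lambda>(p, a). u (p * m + a))" and u = u] by simp
  qed
  finally show ?thesis .
qed

text \<open>For \<open>U = v w\<^sup>T\<close> the matrix \<open>U\<^sup>T X U\<close> is \<open>(v\<^sup>T X v) w w\<^sup>T\<close>: elementary tensors compress the tensor
  combination to a linear combination of the \<open>A i\<close> with the scalar coefficients \<open>v\<^sup>T (X i) v\<close>.\<close>

lemma trace_pairing_rank_one:
  assumes "X \<in> carrier_mat d d"
  shows "trace_pairing m A (transpose_mat (mat d m (\<lambda>(p, a). v p * w a)) * X * mat d m (\<lambda>(p, a). v p * w a))
    = quad_form d X v * quad_form m A w"
proof -
  have "trace_pairing m A (transpose_mat (mat d m (\<lambda>(p, a). v p * w a)) * X * mat d m (\<lambda>(p, a). v p * w a))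
    = (\<Sum>p<d. \<Sum>a<m. \<Sum>q<d. \<Sum>b<m. (v p * X $$ (p, q) * v q) * (w a * A $$ (a, b) * w b))"
    using assms by (simp add: trace_pairing_congruence mult_ac)
  also have "\<dots> = (\<Sum>p<d. \<Sum>q<d. \<Sum>a<m. \<Sum>b<m. (v p * X $$ (p, q) * v q) * (w a * A $$ (a, b) * w b))"
    by (subst (2) sum.swap) (rule refl)
  finally show ?thesis
    unfolding quad_form_def sum_distrib_right by (simp add: sum_distrib_left)
qed

text \<open>This is the positivity of \<open>I \<otimes> A\<close> for positive semidefinite \<open>A\<close>: the matrix is block diagonal
  with copies of \<open>A\<close>, and the rows of \<open>U\<close> are the blocks of the vector.\<close>

lemma trace_pairing_gram:
  assumes U: "U \<in> carrier_mat d m"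
  shows "trace_pairing m A (transpose_mat U * U) = (\<Sum>p<d. quad_form m A (\<lambda>a. U $$ (p, a)))"
proof -
  have "(\<Sum>q<d. \<Sum>b<m. U $$ (p, a) * (1\<^sub>m d $$ (p, q) * A $$ (a, b)) * U $$ (q, b))
      = (\<Sum>b<m. U $$ (p, a) * A $$ (a, b) * U $$ (p, b))" if "p < d" for p a
  proof -
    have "(\<Sum>q<d. \<Sum>b<m. U $$ (p, a) * (1\<^sub>m d $$ (p, q) * A $$ (a, b)) * U $$ (q, b))
      = (\<Sum>q<d. if p = q then \<Sum>b<m. U $$ (p, a) * A $$ (a, b) * U $$ (p, b) else 0)"
      using that by (intro sum.cong) auto
    then show ?thesis using that by simp
  qed
  then show ?thesis
    using trace_pairing_congruence[OF one_carrier_mat U, of A] U by (simp add: quad_form_def)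
qed

section \<open>Pencils, coefficient spans and ampliations\<close>

lemma index_finsum_mat:
  assumes "finite F" "\<And>k. k \<in> F \<Longrightarrow> f k \<in> carrier_mat nr nc"
  shows "finsum (module_mat TYPE(real) nr nc) f F \<in> carrier_mat nr nc \<and>
    (\<forall>i<nr. \<forall>j<nc. finsum (module_mat TYPE(real) nr nc) f F $$ (i, j) = (\<Sum>k\<in>F. f k $$ (i, j)))"
proof -
  interpret matrix_vs nr nc "TYPE(real)" .
  show ?thesis using assms
  proof (induction F rule: finite_induct)
    case (insert x F)
    then have "finsum (module_mat TYPE(real) nr nc) f (insert x F) =
        f x + finsum (module_mat TYPE(real) nr nc) f F"
      by (intro finsum_insert) auto
    moreover have fin: "finsum (module_mat TYPE(real) nr nc) f F \<in> carrier_mat nr nc"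
      using insert by auto
    ultimately show ?case using insert carrier_matD[OF fin] by auto
  qed simp
qed

lemma pencil_eval_eq_lin_comb:
  assumes "linear_pencil n m A"
  shows "pencil_eval n m A x = lin_comb n m (case_nat 1 (\<lambda>i. x $ i)) A"
proof -
  note A = linear_pencil_carrier[OF assms]
  have "\<And>i. i < n \<Longrightarrow> x $ i \<cdot>\<^sub>m A (Suc i) \<in> carrier_mat m m" using A by auto
  with index_finsum_mat[of "{..<n}" "\<lambda>i. x $ i \<cdot>\<^sub>m A (Suc i)" m m] show ?thesis
    using A carrier_matD[OF A]
    by (intro eq_matI) (auto simp: pencil_eval_def lin_comb_def sum.atMost_shift)
qed

lemma pencil_eval_mat_eq_tensor_comb:
  assumes pencil: "linear_pencil n m A"
    and Z: "length Z = n" "set Z \<subseteq> carrier_mat d d"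
  shows "pencil_eval_mat n m A d Z = tensor_comb n d m (case_nat (1\<^sub>m d) (\<lambda>i. Z ! i)) A"
proof -
  note A = linear_pencil_carrier[OF pencil]
  have Zi: "Z ! i \<in> carrier_mat d d" if "i < n" for i using Z that by auto
  have "kronecker (Z ! i) (A (Suc i)) \<in> carrier_mat (d * m) (d * m)" if "i < n" for i
    using A[of "Suc i"] Zi[OF that] that by (auto simp: kronecker_def)
  with index_finsum_mat[of "{..<n}" "\<lambda>i. kronecker (Z ! i) (A (Suc i))" "d * m" "d * m"]
  show ?thesis
    using A[of 0] A Zi
    by (intro eq_matI)
      (auto simp: pencil_eval_mat_def tensor_comb_def sum.atMost_shift kronecker_def
        carrier_matD[OF A] carrier_matD[OF Zi])
qed

lemma coeff_span_submodule:
  assumes "linear_pencil n m A"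
  shows "submodule class_ring (coeff_span n m A) (module_mat TYPE(real) m m)"
    and "A ` {..n} \<subseteq> coeff_span n m A"
proof -
  interpret matrix_vs m m "TYPE(real)" .
  have "A ` {..n} \<subseteq> carrier_mat m m" using linear_pencil_carrier[OF assms] by auto
  then show "submodule class_ring (coeff_span n m A) (module_mat TYPE(real) m m)"
      "A ` {..n} \<subseteq> coeff_span n m A"
    unfolding coeff_span_def by (auto intro: span_is_submodule dest: in_own_span)
qed

lemma lin_comb_0:
  assumes "A 0 \<in> carrier_mat m m"
  shows "lin_comb 0 m c A = c 0 \<cdot>\<^sub>m A 0"
  using assms by (intro eq_matI) (auto simp: lin_comb_def)

lemma lin_comb_Suc:
  assumes "A (Suc n) \<in> carrier_mat m m"
  shows "lin_comb (Suc n) m c A = lin_comb n m c A + c (Suc n) \<cdot>\<^sub>m A (Suc n)"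
  using assms by (intro eq_matI) (auto simp: lin_comb_def)

lemma lin_comb_in_coeff_span:
  assumes A: "linear_pencil n m A" and "k \<le> n"
  shows "lin_comb k m c A \<in> coeff_span n m A"
  using \<open>k \<le> n\<close>
proof (induction k)
  case 0
  note sub = coeff_span_submodule[OF A]
  have "A 0 \<in> coeff_span n m A" using sub(2) by auto
  then show ?case
    using submodule.smult_closed[OF sub(1)] linear_pencil_carrier[OF A, of 0]
    by (simp add: module_mat_simps lin_comb_0)
next
  case (Suc k)
  note sub = coeff_span_submodule[OF A]
  have "A (Suc k) \<in> coeff_span n m A" using sub(2) Suc.prems by auto
  then have "c (Suc k) \<cdot>\<^sub>m A (Suc k) \<in> coeff_span n m A"
    using submodule.smult_closed[OF sub(1)] by (simp add: module_mat_simps)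
  then show ?case
    using submodule.m_closed[OF sub(1)] Suc linear_pencil_carrier[OF A]
    by (simp add: module_mat_simps lin_comb_Suc)
qed

lemma coeff_span_eq:
  assumes A: "linear_pencil n m A"
  shows "coeff_span n m A = range (\<lambda>c. lin_comb n m c A)"
proof
  interpret matrix_vs m m "TYPE(real)" .
  have "A i = lin_comb n m (\<lambda>j. of_bool (j = i)) A" if "i \<le> n" for i
    using linear_pencil_carrier[OF A that] that
    by (intro eq_matI) (auto simp: lin_comb_def if_distrib[of "\<lambda>c. c * _"] of_bool_def cong: if_cong)
  then have gen: "A ` {..n} \<subseteq> range (\<lambda>c. lin_comb n m c A)" by blast
  have add: "lin_comb n m c A + lin_comb n m c' A = lin_comb n m (\<lambda>i. c i + c' i) A" for c c'
    by (intro eq_matI) (auto simp: lin_comb_def sum.distrib distrib_right)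
  have smult: "k \<cdot>\<^sub>m lin_comb n m c A = lin_comb n m (\<lambda>i. k * c i) A" for k c
    by (intro eq_matI) (auto simp: lin_comb_def sum_distrib_left mult.assoc)
  have zero: "0\<^sub>m m m = lin_comb n m (\<lambda>_. 0) A"
    by (intro eq_matI) (auto simp: lin_comb_def)
  have "submodule class_ring (range (\<lambda>c. lin_comb n m c A)) (module_mat TYPE(real) m m)"
    using zero by unfold_locales (auto simp: module_mat_simps add smult)
  with gen show "coeff_span n m A \<subseteq> range (\<lambda>c. lin_comb n m c A)"
    unfolding coeff_span_def by (intro span_is_subset)
  show "range (\<lambda>c. lin_comb n m c A) \<subseteq> coeff_span n m A"
    using lin_comb_in_coeff_span[OF A] by blast
qed

text \<open>Stated for the partial combinations up to \<open>k\<close>, which stay in the span of all \<open>n + 1\<close>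
  coefficients, so that induction on \<open>k\<close> applies.\<close>

lemma linear_on_mats_lin_comb:
  assumes A: "linear_pencil n m A"
    and B: "linear_pencil n m' B"
    and lin: "linear_on_mats m (coeff_span n m A) m' (coeff_span n m' B) \<tau>"
    and \<tau>: "\<And>i. i \<le> n \<Longrightarrow> \<tau> (A i) = B i"
    and "k \<le> n"
  shows "\<tau> (lin_comb k m c A) = lin_comb k m' c B"
proof -
  note sub = coeff_span_submodule[OF A]
  have hom: "\<tau> \<in> LinearCombinations.module_hom class_ring
       ((module_mat TYPE(real) m m)\<lparr>carrier := coeff_span n m A\<rparr>)
       ((module_mat TYPE(real) m' m')\<lparr>carrier := coeff_span n m' B\<rparr>)"
    using lin by (simp add: linear_on_mats_def linear_map_def mod_hom_def mod_hom_axioms_def)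
  note A_carrier = linear_pencil_carrier[OF A] and B_carrier = linear_pencil_carrier[OF B]
  have smult: "\<tau> (c i \<cdot>\<^sub>m A i) = c i \<cdot>\<^sub>m B i" if "i \<le> n" for i
    using LinearCombinations.module_hom_smult[OF hom, of "c i" "A i"] sub(2) that \<tau>
    by (auto simp: module_mat_simps)
  show ?thesis using \<open>k \<le> n\<close>
  proof (induction k)
    case 0
    show ?case using smult[of 0] A_carrier[of 0] B_carrier[of 0] by (simp add: lin_comb_0)
  next
    case (Suc k)
    have "c (Suc k) \<cdot>\<^sub>m A (Suc k) \<in> coeff_span n m A"
      using submodule.smult_closed[OF sub(1), of "c (Suc k)" "A (Suc k)"] sub(2) Suc.prems
      by (auto simp: module_mat_simps)
    then have "\<tau> (lin_comb k m c A + c (Suc k) \<cdot>\<^sub>m A (Suc k)) =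
        \<tau> (lin_comb k m c A) + \<tau> (c (Suc k) \<cdot>\<^sub>m A (Suc k))"
      using LinearCombinations.module_hom_add[OF hom, of "lin_comb k m c A"]
        lin_comb_in_coeff_span[OF A, of k c] Suc.prems
      by (simp add: module_mat_simps)
    then show ?case
      using Suc smult[of "Suc k"] A_carrier[of "Suc k"] B_carrier[of "Suc k"]
      by (simp add: lin_comb_Suc)
  qed
qed

lemma mat_block_tensor_comb:
  assumes "p < d" "q < d"
  shows "mat_block m (tensor_comb n d m X A) p q = lin_comb n m (\<lambda>i. X i $$ (p, q)) A"
  using assms by (intro eq_matI) (auto simp: mat_block_def lin_comb_def tensor_comb_entry)

lemma tensor_comb_in_block_mats:
  assumes "linear_pencil n m A"
  shows "tensor_comb n d m X A \<in> block_mats d m (coeff_span n m A)"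
  using lin_comb_in_coeff_span[OF assms] by (simp add: block_mats_def mat_block_tensor_comb)

lemma ampliation_tensor_comb:
  assumes "\<And>c. \<tau> (lin_comb n m c A) = lin_comb n m' c B"
  shows "ampliation d m m' \<tau> (tensor_comb n d m X A) = tensor_comb n d m' X B"
proof (rule eq_matI)
  fix r s assume "r < dim_row (tensor_comb n d m' X B)" "s < dim_col (tensor_comb n d m' X B)"
  then have rs: "r < d * m'" "s < d * m'" by (auto simp: tensor_comb_def)
  then have "ampliation d m m' \<tau> (tensor_comb n d m X A) $$ (r, s) =
      \<tau> (mat_block m (tensor_comb n d m X A) (r div m') (s div m')) $$ (r mod m', s mod m')"
    by (simp add: ampliation_def)
  also have "\<dots> = tensor_comb n d m' X B $$ (r, s)"
    unfolding mat_block_tensor_comb[OF div_mod_block_less(1)[OF rs(1)] div_mod_block_less(1)[OF rs(2)]] assms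
    using rs by (simp add: lin_comb_def tensor_comb_def div_mod_block_less)
  finally show "ampliation d m m' \<tau> (tensor_comb n d m X A) $$ (r, s) = tensor_comb n d m' X B $$ (r, s)" .
qed (auto simp: ampliation_def tensor_comb_def)

text \<open>The coefficients \<open>c p q i\<close> of the blocks in terms of \<open>A i\<close>, reordered by \<open>i\<close>, are the matrices \<open>X i\<close>.\<close>

lemma block_mats_imp_tensor_comb:
  assumes A: "linear_pencil n m A"
    and Y: "Y \<in> block_mats d m (coeff_span n m A)"
  obtains X where "\<forall>i\<le>n. X i \<in> carrier_mat d d" "Y = tensor_comb n d m X A"
proof -
  have "\<exists>c. mat_block m Y p q = lin_comb n m c A" if "p < d" "q < d" for p q
  proof -
    have "mat_block m Y p q \<in> coeff_span n m A" using that Y by (simp add: block_mats_def)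
    then show ?thesis by (auto simp: coeff_span_eq[OF A])
  qed
  then obtain c where c: "\<And>p q. p < d \<Longrightarrow> q < d \<Longrightarrow> mat_block m Y p q = lin_comb n m (c p q) A"
    by metis
  define X where "X i = mat d d (\<lambda>(p, q). c p q i)" for i
  have Yc: "Y \<in> carrier_mat (d * m) (d * m)" using Y by (simp add: block_mats_def)
  have "Y = tensor_comb n d m X A"
  proof (rule eq_matI)
    fix r s assume "r < dim_row (tensor_comb n d m X A)" "s < dim_col (tensor_comb n d m X A)"
    then have rs: "r < d * m" "s < d * m" by (auto simp: tensor_comb_def)
    have "Y $$ (r, s) = mat_block m Y (r div m) (s div m) $$ (r mod m, s mod m)"
      using rs by (simp add: mat_block_def div_mod_block_less)
    also have "\<dots> = tensor_comb n d m X A $$ (r, s)"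
      using rs by (simp add: c div_mod_block_less lin_comb_def tensor_comb_def X_def)
    finally show "Y $$ (r, s) = tensor_comb n d m X A $$ (r, s)" .
  qed (use Yc in \<open>auto simp: tensor_comb_def\<close>)
  then show thesis by (rule that[rotated]) (simp add: X_def)
qed

section \<open>Consequences of boundedness\<close>

text \<open>Polarisation on pairs of unit vectors.\<close>

lemma quad_form_zero_imp_zero:
  assumes A: "A \<in> symmetric_mats m" and q: "\<And>u. quad_form m A u = 0"
  shows "A = 0\<^sub>m m m"
proof (rule eq_matI)
  fix a b assume "a < dim_row (0\<^sub>m m m :: real mat)" "b < dim_col (0\<^sub>m m m :: real mat)"
  then have ab: "a < m" "b < m" by auto
  \<comment> \<open>For \<open>i = j\<close> this is the value at twice a unit vector, which isolates the diagonal entries.\<close>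
  have unit: "quad_form m A (\<lambda>k. of_bool (k = i) + of_bool (k = j)) =
      A $$ (i, i) + A $$ (i, j) + A $$ (j, i) + A $$ (j, j)" if "i < m" "j < m" for i j
    using that by (simp add: quad_form_def of_bool_def distrib_left distrib_right sum.distrib
        if_distrib[of "\<lambda>x. x * _"] if_distrib[of "\<lambda>x. _ * x"] cong: if_cong)
  have diag: "A $$ (i, i) = 0" if "i < m" for i using unit[OF that that] q by simp
  show "A $$ (a, b) = 0\<^sub>m m m $$ (a, b)"
    using unit[OF ab] diag ab symmetric_mats_sym[OF A ab] q by simp
qed (use symmetric_mats_carrier[OF A] in auto)

locale bounded_pencil =
  fixes n m :: nat and A :: "nat \<Rightarrow> real mat"
  assumes pencil: "linear_pencil n m A"
    and A0_nonzero: "A 0 \<noteq> 0\<^sub>m m m"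
    and A0_psd: "psd (A 0)"
    and bounded: "bounded_vecs (spectrahedron n m A)"
begin

lemma A_carrier: "i \<le> n \<Longrightarrow> A i \<in> carrier_mat m m"
  by (rule linear_pencil_carrier[OF pencil])

lemma A0_quad_form_nonneg: "0 \<le> quad_form m (A 0) u"
  using A0_psd psd_iff_quad_form[OF A_carrier[of 0]] by simp

text \<open>If \<open>c\<close> has no constant term and its combination is positive semidefinite, then the whole ray
  through \<open>c\<close> lies in the spectrahedron, because \<open>A 0\<close> is positive semidefinite as well.
  Boundedness makes the ray degenerate.\<close>

lemma no_recession_direction:
  assumes nonneg: "\<And>w. 0 \<le> quad_form m (lin_comb n m c A) w" and c0: "c 0 = 0" and "i \<le> n"
  shows "c i = 0"
proof (rule ccontr)
  assume "c i \<noteq> 0"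
  define s where "s = (\<Sum>j<n. (c (Suc j))\<^sup>2)"
  obtain j where j: "i = Suc j" "j < n" using \<open>c i \<noteq> 0\<close> c0 \<open>i \<le> n\<close> by (cases i) auto
  have "0 < (c (Suc j))\<^sup>2" using \<open>c i \<noteq> 0\<close> j by simp
  also have "\<dots> \<le> s" unfolding s_def using j by (intro member_le_sum) auto
  finally have "0 < s" .
  obtain B where B: "\<And>x. x \<in> spectrahedron n m A \<Longrightarrow> sqrt (x \<bullet> x) \<le> B"
    using bounded by (auto simp: bounded_vecs_def)
  \<comment> \<open>The point \<open>t c\<close> of the ray has norm \<open>\<bar>B\<bar> + 1\<close>, beyond the bound \<open>B\<close>.\<close>
  define t where "t = (\<bar>B\<bar> + 1) / sqrt s"
  have t: "0 \<le> t" using \<open>0 < s\<close> by (simp add: t_def)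
  define x where "x = vec n (\<lambda>j. t * c (Suc j))"
  have "0 \<le> quad_form m (pencil_eval n m A x) w" for w
  proof -
    have "quad_form m (pencil_eval n m A x) w =
        quad_form m (A 0) w + t * (\<Sum>j<n. c (Suc j) * quad_form m (A (Suc j)) w)"
      by (simp add: pencil_eval_eq_lin_comb[OF pencil]
          quad_form_lin_comb sum.atMost_shift x_def sum_distrib_left mult.assoc)
    also have "\<dots> = quad_form m (A 0) w + t * quad_form m (lin_comb n m c A) w"
      by (simp add: quad_form_lin_comb sum.atMost_shift c0)
    finally show ?thesis using A0_quad_form_nonneg nonneg t by simp
  qed
  then have "psd (pencil_eval n m A x)"
    using lin_comb_symmetric[OF pencil]
    by (simp add: pencil_eval_eq_lin_comb[OF pencil]
        psd_iff_quad_form[OF lin_comb_carrier])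
  then have "sqrt (x \<bullet> x) \<le> B" by (intro B) (simp add: spectrahedron_def x_def)
  moreover have "x \<bullet> x = t\<^sup>2 * s"
    by (simp add: x_def scalar_prod_def s_def atLeast0LessThan sum_distrib_left power2_eq_square mult_ac)
  ultimately have "\<bar>B\<bar> + 1 \<le> B" using t \<open>0 < s\<close> by (simp add: real_sqrt_mult t_def)
  then show False by linarith
qed

text \<open>A negative constant coefficient can be dropped without losing positivity, as \<open>A 0\<close> is positive
  semidefinite. The remaining coefficients then form a recession direction and vanish, which leaves
  \<open>c 0 \<cdot> A 0\<close> positive semidefinite with \<open>c 0 < 0\<close>. This forces \<open>A 0 = 0\<close>.\<close>

lemma constant_coeff_nonneg:
  assumes nonneg: "\<And>w. 0 \<le> quad_form m (lin_comb n m c A) w"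
  shows "0 \<le> c 0"
proof (rule ccontr)
  assume "\<not> 0 \<le> c 0"
  then have neg: "c 0 < 0" by simp
  let ?c = "c(0 := 0)"
  have split: "quad_form m (lin_comb n m c A) w =
      c 0 * quad_form m (A 0) w + quad_form m (lin_comb n m ?c A) w" for w
    by (simp add: quad_form_lin_comb sum.atMost_shift)
  have "0 \<le> quad_form m (lin_comb n m ?c A) w" for w
    using nonneg[of w] split[of w] mult_nonpos_nonneg[OF _ A0_quad_form_nonneg, of "c 0" w] neg
    by linarith
  then have "?c i = 0" if "i \<le> n" for i using no_recession_direction[of ?c i] that by simp
  then have "quad_form m (lin_comb n m ?c A) w = 0" for w
    by (simp add: quad_form_lin_comb)
  then have "0 \<le> c 0 * quad_form m (A 0) w" for w using nonneg[of w] split[of w] by simp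
  then have "quad_form m (A 0) w = 0" for w
    using neg A0_quad_form_nonneg[of w] by (metis mult_less_0_iff not_less order_less_le)
  then have "A 0 = 0\<^sub>m m m" by (intro quad_form_zero_imp_zero linear_pencilD[OF pencil]) simp
  then show False using A0_nonzero by simp
qed

text \<open>Both \<open>c\<close> and \<open>-c\<close> give a positive semidefinite combination, so the constant coefficient is zero
  and the rest is a recession direction.\<close>

lemma coeffs_independent:
  assumes zero: "lin_comb n m c A = 0\<^sub>m m m" and "i \<le> n"
  shows "c i = 0"
proof -
  have q: "quad_form m (lin_comb n m c A) w = 0" for w
    by (simp add: zero quad_form_def)
  have "quad_form m (lin_comb n m (\<lambda>i. - c i) A) w = 0" for w
    using q[of w] by (simp add: quad_form_lin_comb sum_negf)
  with q have "c 0 = 0"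
    using constant_coeff_nonneg[of c] constant_coeff_nonneg[of "\<lambda>i. - c i"] by simp
  then show ?thesis using no_recession_direction[of c i] q \<open>i \<le> n\<close> by simp
qed

text \<open>Comparing the blocks \<open>(p, q)\<close> and \<open>(q, p)\<close> of the symmetric matrix gives two expansions of one
  matrix in the linearly independent \<open>A i\<close>.\<close>

lemma symmetric_tensor_coeffs:
  assumes X: "\<forall>i\<le>n. X i \<in> carrier_mat d d"
    and Y: "tensor_comb n d m X A \<in> symmetric_mats (d * m)"
  shows "linear_pencil n d X"
  unfolding linear_pencil_def
proof (intro allI impI)
  fix i assume i: "i \<le> n"
  have "X i $$ (p, q) = X i $$ (q, p)" if pq: "p < d" "q < d" for p q
  proof -
    have "lin_comb n m (\<lambda>i. X i $$ (p, q) - X i $$ (q, p)) A = 0\<^sub>m m m"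
    proof (rule eq_matI)
      fix a b assume "a < dim_row (0\<^sub>m m m :: real mat)" "b < dim_col (0\<^sub>m m m :: real mat)"
      then have ab: "a < m" "b < m" by auto
      have "(\<Sum>i\<le>n. X i $$ (p, q) * A i $$ (a, b)) = (\<Sum>i\<le>n. X i $$ (q, p) * A i $$ (b, a))"
        using symmetric_mats_sym[OF Y block_index_less[OF pq(1) ab(1)] block_index_less[OF pq(2) ab(2)]]
        by (simp add: tensor_comb_entry pq ab)
      also have "\<dots> = (\<Sum>i\<le>n. X i $$ (q, p) * A i $$ (a, b))"
        using symmetric_mats_sym[OF linear_pencilD[OF pencil] ab] by (intro sum.cong) auto
      finally show "lin_comb n m (\<lambda>i. X i $$ (p, q) - X i $$ (q, p)) A $$ (a, b) = 0\<^sub>m m m $$ (a, b)"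
        using ab by (simp add: lin_comb_def left_diff_distrib sum_subtractf)
    qed (auto simp: lin_comb_def)
    from coeffs_independent[OF this i] show ?thesis by simp
  qed
  then show "X i \<in> symmetric_mats d" using X i by (simp add: symmetric_mats_iff_entries)
qed

text \<open>Elementary tensors reduce the claim for \<open>X 0\<close> to the scalar statement for the coefficient
  \<open>v\<^sup>T (X 0) v\<close>.\<close>

lemma psd_tensor_comb_imp_constant_coeff_nonneg:
  assumes X: "linear_pencil n d X" and psd: "psd (tensor_comb n d m X A)"
  shows "0 \<le> quad_form d (X 0) v"
proof -
  have "0 \<le> quad_form m (lin_comb n m (\<lambda>i. quad_form d (X i) v) A) w" for w
  proof -
    have "quad_form m (lin_comb n m (\<lambda>i. quad_form d (X i) v) A) w =
      (\<Sum>i\<le>n. trace_pairing m (A i) (transpose_mat (mat d m (\<lambda>(p, a). v p * w a)) * X i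
        * mat d m (\<lambda>(p, a). v p * w a)))"
      using linear_pencil_carrier[OF X] by (simp add: trace_pairing_rank_one quad_form_lin_comb)
    then show ?thesis using psd psd_tensor_comb_iff[OF X pencil] by simp
  qed
  then show ?thesis by (rule constant_coeff_nonneg)
qed

end

section \<open>Normalising a positive definite constant coefficient\<close>

text \<open>The constant coefficient of a tensor combination has to be moved to the identity without
  leaving the real symmetric matrices. Instead of a square root, a basis orthonormal for the
  form \<open>X 0\<close> is used.\<close>

lemma symmetric_mats_congruence:
  assumes X: "X \<in> symmetric_mats d" and P: "P \<in> carrier_mat d d"
  shows "transpose_mat P * X * P \<in> symmetric_mats d"
proof -
  have X': "X \<in> carrier_mat d d" "transpose_mat X = X" using X by (auto simp: symmetric_mats_def)
  have "transpose_mat (transpose_mat P * X * P) = transpose_mat P * (X * P)"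
    using X' P by (simp add: transpose_mult[of _ d d _ d])
  also have "\<dots> = transpose_mat P * X * P"
    using X' P by (simp add: assoc_mult_mat[of _ d d _ d _ d])
  finally show ?thesis using X' P by (simp add: symmetric_mats_def)
qed

lemma congruence_mult:
  fixes X P U :: "real mat"
  assumes X: "X \<in> carrier_mat d d" and P: "P \<in> carrier_mat d d" and U: "U \<in> carrier_mat d m"
  shows "transpose_mat U * (transpose_mat P * X * P) * U = transpose_mat (P * U) * X * (P * U)"
proof -
  have "transpose_mat (P * U) * X * (P * U) = transpose_mat U * transpose_mat P * X * (P * U)"
    using P U by (simp add: transpose_mult[OF P U])
  also have "\<dots> = transpose_mat U * (transpose_mat P * X * P) * U"
    using X P U by (simp add: assoc_mult_mat[of _ m d _ d _ d]
        assoc_mult_mat[of _ m d _ d _ m] assoc_mult_mat[of _ d d _ d _ m] assoc_mult_mat[of _ d d _ d _ d])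
  finally show ?thesis by simp
qed

text \<open>A new vector orthogonal to \<open>k < d\<close> given ones solves \<open>k\<close> homogeneous linear equations in \<open>d\<close>
  unknowns. Filled up with zero rows, the system has determinant zero, hence a nonzero solution,
  and positive definiteness permits it to be normalised.\<close>

lemma orthonormal_families_exist:
  fixes X :: "real mat"
  assumes X: "X \<in> symmetric_mats d" and "k \<le> d"
    and pos: "\<And>v. v \<in> carrier_vec d \<Longrightarrow> v \<noteq> 0\<^sub>v d \<Longrightarrow> 0 < v \<bullet> (X *\<^sub>v v)"
  shows "\<exists>f. (\<forall>i<k. f i \<in> carrier_vec d) \<and> (\<forall>i<k. \<forall>j<k. f i \<bullet> (X *\<^sub>v f j) = of_bool (i = j))"
  using \<open>k \<le> d\<close>
proof (induction k)
  case (Suc k)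
  then obtain f where f: "\<And>i. i < k \<Longrightarrow> f i \<in> carrier_vec d"
    and orth: "\<And>i j. i < k \<Longrightarrow> j < k \<Longrightarrow> f i \<bullet> (X *\<^sub>v f j) = of_bool (i = j)" by auto
  have Xc: "X \<in> carrier_mat d d" by (rule symmetric_mats_carrier[OF X])
  have sym: "u \<bullet> (X *\<^sub>v v) = v \<bullet> (X *\<^sub>v u)" if "u \<in> carrier_vec d" "v \<in> carrier_vec d" for u v
    using that Xc X transpose_vec_mult_scalar[of X d d v u]
    by (simp add: symmetric_mats_def comm_scalar_prod[of _ d])
  \<comment> \<open>A nonzero kernel vector of \<open>?M\<close> is orthogonal to all \<open>f i\<close> for the form \<open>X\<close>. Row \<open>k\<close> is tested
    first to match the shape of \<open>det_row_0\<close>.\<close>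
  let ?M = "mat\<^sub>r d d (\<lambda>i. if i = k then 0\<^sub>v d else if i < k then X *\<^sub>v f i else 0\<^sub>v d)"
  have "det ?M = 0" using Suc.prems f Xc by (intro det_row_0) auto
  moreover have "?M \<in> carrier_mat d d" by simp
  ultimately obtain v where v: "v \<in> carrier_vec d" "v \<noteq> 0\<^sub>v d" and Mv: "?M *\<^sub>v v = 0\<^sub>v d"
    using det_0_iff_vec_prod_zero by blast
  have vf: "v \<bullet> (X *\<^sub>v f i) = 0" if "i < k" for i
  proof -
    have "(?M *\<^sub>v v) $ i = (X *\<^sub>v f i) \<bullet> v" using that Suc.prems f Xc by simp
    then show ?thesis using Mv that Suc.prems v f Xc by (simp add: comm_scalar_prod[of _ d])
  qed
  define s where "s = sqrt (v \<bullet> (X *\<^sub>v v))"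
  have "0 < s" and ss: "v \<bullet> (X *\<^sub>v v) = s * s" using pos[OF v] by (simp_all add: s_def)
  define g where "g = f(k := (1 / s) \<cdot>\<^sub>v v)"
  have fv: "f i \<bullet> (X *\<^sub>v v) = 0" if "i < k" for i using vf sym[OF v(1) f] that by simp
  have Xs: "X *\<^sub>v ((1 / s) \<cdot>\<^sub>v v) = (1 / s) \<cdot>\<^sub>v (X *\<^sub>v v)"
    using Xc v(1) by (rule mult_mat_vec)
  have "g i \<in> carrier_vec d" if "i < Suc k" for i
    using that f v by (auto simp: g_def less_Suc_eq)
  moreover have "g i \<bullet> (X *\<^sub>v g j) = of_bool (i = j)" if "i < Suc k" "j < Suc k" for i j
    using that orth vf fv ss \<open>0 < s\<close> f v Xc
    by (auto simp: g_def less_Suc_eq Xs)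
  ultimately show ?case by blast
qed simp

lemma pos_def_congruent_one:
  fixes X :: "real mat"
  assumes X: "X \<in> symmetric_mats d"
    and pos: "\<And>v. v \<in> carrier_vec d \<Longrightarrow> v \<noteq> 0\<^sub>v d \<Longrightarrow> 0 < v \<bullet> (X *\<^sub>v v)"
  obtains P Q where "P \<in> carrier_mat d d" "Q \<in> carrier_mat d d" "P * Q = 1\<^sub>m d"
    "transpose_mat P * X * P = 1\<^sub>m d"
proof -
  obtain f where f: "\<And>i. i < d \<Longrightarrow> f i \<in> carrier_vec d"
    and orth: "\<And>i j. i < d \<Longrightarrow> j < d \<Longrightarrow> f i \<bullet> (X *\<^sub>v f j) = of_bool (i = j)"
    using orthonormal_families_exist[OF X order_refl pos] by auto
  have Xc: "X \<in> carrier_mat d d" by (rule symmetric_mats_carrier[OF X])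
  define P where "P = mat_of_cols d (map f [0..<d])"
  have P: "P \<in> carrier_mat d d" using mat_of_cols_carrier(1)[of d "map f [0..<d]"] by (simp add: P_def)
  have col: "col P i = f i" if "i < d" for i
    using that f by (simp add: P_def col_mat_of_cols)
  have "transpose_mat P * (X * P) = 1\<^sub>m d"
  proof (rule eq_matI)
    fix i j assume "i < dim_row (1\<^sub>m d :: real mat)" "j < dim_col (1\<^sub>m d :: real mat)"
    then have ij: "i < d" "j < d" by auto
    have "col (X * P) j = X *\<^sub>v f j" using ij P Xc col by (simp add: col_mult2[of _ d d _ d] mult_mat_vec_def)
    then show "(transpose_mat P * (X * P)) $$ (i, j) = 1\<^sub>m d $$ (i, j)"
      using ij P Xc col orth by simp
  qed (use P Xc in auto)
  then have one: "transpose_mat P * X * P = 1\<^sub>m d"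
    using P Xc by (simp add: assoc_mult_mat[of _ d d _ d _ d])
  have "P * (transpose_mat P * X) = 1\<^sub>m d"
    by (rule mat_mult_left_right_inverse[OF _ P one]) (use P Xc in auto)
  then show thesis using P Xc one by (intro that[of P "transpose_mat P * X"]) auto
qed

text \<open>With \<open>P\<^sup>T (X 0) P = I\<close>, the congruent tuple \<open>P\<^sup>T (X i) P\<close> for \<open>i \<ge> 1\<close> is a point of the matricial
  spectrahedron of \<open>A\<close>. The inclusion puts it into that of \<open>B\<close>, and the inverse congruence by \<open>Q\<close>
  returns to \<open>X\<close>.\<close>

lemma psd_transfer_of_pos_def:
  assumes A: "linear_pencil n m A" and B: "linear_pencil n m' B"
    and incl: "matricial_spectrahedron_at n m A d \<subseteq> matricial_spectrahedron_at n m' B d"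
    and X: "linear_pencil n d X"
    and pos: "\<And>v. v \<in> carrier_vec d \<Longrightarrow> v \<noteq> 0\<^sub>v d \<Longrightarrow> 0 < v \<bullet> (X 0 *\<^sub>v v)"
    and psd: "psd (tensor_comb n d m X A)"
  shows "psd (tensor_comb n d m' X B)"
proof -
  obtain P Q where P: "P \<in> carrier_mat d d" and Q: "Q \<in> carrier_mat d d"
    and PQ: "P * Q = 1\<^sub>m d" and one: "transpose_mat P * X 0 * P = 1\<^sub>m d"
    using pos_def_congruent_one[OF linear_pencilD[OF X, of 0] pos] by blast
  note Xc = linear_pencil_carrier[OF X]
  define W where "W i = transpose_mat P * X i * P" for i
  have W: "linear_pencil n d W"
    using symmetric_mats_congruence[OF linear_pencilD[OF X] P] by (simp add: linear_pencil_def W_def)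
  define Z where "Z = map (\<lambda>i. W (Suc i)) [0..<n]"
  have Z: "length Z = n" "set Z \<subseteq> symmetric_mats d" using W by (auto simp: Z_def linear_pencil_def)
  then have Z': "set Z \<subseteq> carrier_mat d d" using symmetric_mats_carrier by blast
  have tensor: "pencil_eval_mat n k C d Z = tensor_comb n d k W C"
    if "linear_pencil n k C" for k C
  proof -
    have "pencil_eval_mat n k C d Z = tensor_comb n d k (case_nat (1\<^sub>m d) ((!) Z)) C"
      using that Z(1) Z' by (rule pencil_eval_mat_eq_tensor_comb)
    also have "\<dots> = tensor_comb n d k W C"
      by (simp add: tensor_comb_def sum.atMost_shift Z_def one[folded W_def])
    finally show ?thesis .
  qed
  have "psd (tensor_comb n d m W A)"
    using psd X A W P Xc by (auto simp: psd_tensor_comb_iff W_def congruence_mult[of _ d])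
  then have "Z \<in> matricial_spectrahedron_at n m A d"
    using Z A by (simp add: matricial_spectrahedron_at_def tensor)
  then have W_psd: "psd (tensor_comb n d m' W B)"
    using incl by (auto simp: matricial_spectrahedron_at_def tensor[OF B, symmetric])
  have "0 \<le> (\<Sum>i\<le>n. trace_pairing m' (B i) (transpose_mat U * X i * U))"
    if U: "U \<in> carrier_mat d m'" for U
  proof -
    have QU: "Q * U \<in> carrier_mat d m'" using Q U by simp
    have "P * (Q * U) = U"
      using P Q U PQ by (simp flip: assoc_mult_mat[of _ d d _ d _ m'])
    then have "transpose_mat (Q * U) * W i * (Q * U) = transpose_mat U * X i * U" if "i \<le> n" for i
      using congruence_mult[OF Xc[OF that] P QU] by (simp add: W_def)
    moreover have "0 \<le> (\<Sum>i\<le>n. trace_pairing m' (B i) (transpose_mat (Q * U) * W i * (Q * U)))"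
      using W_psd W B QU by (simp add: psd_tensor_comb_iff)
    ultimately show ?thesis by simp
  qed
  then show ?thesis using X B by (simp add: psd_tensor_comb_iff)
qed

section \<open>Positivity and inclusion\<close>

lemma trace_pairing_add:
  assumes "B \<in> carrier_mat m m" "C \<in> carrier_mat m m"
  shows "trace_pairing m A (B + C) = trace_pairing m A B + trace_pairing m A C"
  using assms by (simp add: trace_pairing_def distrib_left sum.distrib)

lemma trace_pairing_smult:
  assumes "B \<in> carrier_mat m m"
  shows "trace_pairing m A (k \<cdot>\<^sub>m B) = k * trace_pairing m A B"
  using assms by (simp add: trace_pairing_def sum_distrib_left mult_ac)

text \<open>The constant coefficient \<open>X 0\<close> is positive semidefinite but may be singular. Adding
  \<open>\<epsilon> I \<otimes> A 0\<close> keeps the tensor combination positive semidefinite and makes the constant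
  coefficient definite; then \<open>\<epsilon>\<close> tends to \<open>0\<close>.\<close>

lemma (in bounded_pencil) psd_transfer:
  assumes B: "linear_pencil n m' B"
    and incl: "matricial_spectrahedron_at n m A d \<subseteq> matricial_spectrahedron_at n m' B d"
    and X: "linear_pencil n d X"
    and psd: "psd (tensor_comb n d m X A)"
  shows "psd (tensor_comb n d m' X B)"
proof -
  note Xc = linear_pencil_carrier[OF X]
  define Xe where "Xe \<epsilon> = X(0 := X 0 + \<epsilon> \<cdot>\<^sub>m 1\<^sub>m d)" for \<epsilon> :: real
  have Xe: "linear_pencil n d (Xe \<epsilon>)" for \<epsilon>
    unfolding linear_pencil_def
  proof (intro allI impI)
    fix i assume "i \<le> n"
    then show "Xe \<epsilon> i \<in> symmetric_mats d"
      using linear_pencilD[OF X] symmetric_mats_sym[OF linear_pencilD[OF X]] Xc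
      by (auto simp: Xe_def symmetric_mats_iff_entries)
  qed
  have form: "(\<Sum>i\<le>n. trace_pairing k (C i) (transpose_mat U * Xe \<epsilon> i * U)) =
      (\<Sum>i\<le>n. trace_pairing k (C i) (transpose_mat U * X i * U)) +
      \<epsilon> * trace_pairing k (C 0) (transpose_mat U * U)"
    if U: "U \<in> carrier_mat d k" for \<epsilon> k C U
  proof -
    have "transpose_mat U * (X 0 + \<epsilon> \<cdot>\<^sub>m 1\<^sub>m d) * U =
        transpose_mat U * X 0 * U + \<epsilon> \<cdot>\<^sub>m (transpose_mat U * U)"
      using U Xc[of 0]
      by (simp add: mult_add_distrib_mat[of _ k d] add_mult_distrib_mat[of _ k d]
          mult_smult_distrib[of _ k d _ d] mult_smult_assoc_mat[of _ k d _ k])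
    then show ?thesis
      using U Xc[of 0] by (simp add: sum.atMost_shift Xe_def trace_pairing_add trace_pairing_smult)
  qed
  have approx: "psd (tensor_comb n d m' (Xe \<epsilon>) B)" if "0 < \<epsilon>" for \<epsilon>
  proof (rule psd_transfer_of_pos_def[OF pencil B incl Xe])
    fix v :: "real vec" assume v: "v \<in> carrier_vec d" "v \<noteq> 0\<^sub>v d"
    have "(\<epsilon> \<cdot>\<^sub>m 1\<^sub>m d) *\<^sub>v v = \<epsilon> \<cdot>\<^sub>v v"
      using v(1) by (intro eq_vecI) auto
    then have "v \<bullet> (Xe \<epsilon> 0 *\<^sub>v v) = v \<bullet> (X 0 *\<^sub>v v) + \<epsilon> * (v \<bullet> v)"
      using v Xc[of 0]
      by (simp add: Xe_def add_mult_distrib_mat_vec[of _ d d] 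
          scalar_prod_add_distrib[of _ d])
    moreover have "0 \<le> v \<bullet> (X 0 *\<^sub>v v)"
      using psd_tensor_comb_imp_constant_coeff_nonneg[OF X psd] v Xc[of 0]
      by (simp add: scalar_prod_mult_mat_vec)
    moreover have "0 < v \<bullet> v"
    proof -
      obtain i where "i < d" "v $ i \<noteq> 0" using v by (metis carrier_vecD eq_vecI index_zero_vec)
      then show ?thesis using v
        by (auto simp: scalar_prod_def power2_eq_square[symmetric] intro!: sum_pos2[of _ i])
    qed
    ultimately show "0 < v \<bullet> (Xe \<epsilon> 0 *\<^sub>v v)" using that
      by (metis add_nonneg_pos mult_pos_pos)
  next
    have "0 \<le> trace_pairing m (A 0) (transpose_mat U * U)" if "U \<in> carrier_mat d m" for U
      using that A0_quad_form_nonneg by (simp add: trace_pairing_gram sum_nonneg)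
    then show "psd (tensor_comb n d m (Xe \<epsilon>) A)"
      using psd \<open>0 < \<epsilon>\<close> X Xe pencil by (simp add: psd_tensor_comb_iff form)
  qed
  have "0 \<le> (\<Sum>i\<le>n. trace_pairing m' (B i) (transpose_mat U * X i * U))"
    if U: "U \<in> carrier_mat d m'" for U
  proof -
    define q where "q = (\<Sum>i\<le>n. trace_pairing m' (B i) (transpose_mat U * X i * U))"
    define r where "r = trace_pairing m' (B 0) (transpose_mat U * U)"
    have "0 \<le> q + \<epsilon> * r" if "0 < \<epsilon>" for \<epsilon>
      using approx[OF that] U Xe B
      by (simp add: psd_tensor_comb_iff q_def r_def flip: form)
    then have "eventually (\<lambda>\<epsilon>. 0 \<le> q + \<epsilon> * r) (at_right 0)"
      by (auto simp: eventually_at_right_less eventually_at_filter)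
    moreover have "((\<lambda>\<epsilon>. q + \<epsilon> * r) \<longlongrightarrow> q + 0 * r) (at_right 0)"
      by (intro tendsto_intros)
    ultimately have "0 \<le> q + 0 * r"
      by (intro tendsto_lowerbound) auto
    then show ?thesis by (simp add: q_def)
  qed
  then show ?thesis using X B by (simp add: psd_tensor_comb_iff)
qed

text \<open>For \<open>n \<ge> 1\<close> a tuple determines the size of its matrices, so the union over all sizes loses no
  information. The empty tuple (\<open>n = 0\<close>) has no size of its own, but it then lies in the matricial
  spectrahedron at one size exactly if \<open>B 0\<close> is positive semidefinite, that is, at every size.\<close>

lemma matricial_spectrahedron_subset_iff:
  assumes B: "linear_pencil n m' B"
  shows "matricial_spectrahedron n m A \<subseteq> matricial_spectrahedron n m' B \<longleftrightarrow>
    (\<forall>d\<ge>1. matricial_spectrahedron_at n m A d \<subseteq> matricial_spectrahedron_at n m' B d)"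
proof
  assume incl: "matricial_spectrahedron n m A \<subseteq> matricial_spectrahedron n m' B"
  show "\<forall>d\<ge>1. matricial_spectrahedron_at n m A d \<subseteq> matricial_spectrahedron_at n m' B d"
  proof (intro allI impI subsetI)
    fix d Z assume d: "1 \<le> d" and Z: "Z \<in> matricial_spectrahedron_at n m A d"
    then have "Z \<in> matricial_spectrahedron n m A" by (auto simp: matricial_spectrahedron_def)
    with incl obtain d' where d': "1 \<le> d'" and Z': "Z \<in> matricial_spectrahedron_at n m' B d'"
      by (auto simp: matricial_spectrahedron_def)
    show "Z \<in> matricial_spectrahedron_at n m' B d"
    proof (cases "n = 0")
      case False
      then have "Z ! 0 \<in> symmetric_mats d" "Z ! 0 \<in> symmetric_mats d'"
        using Z Z' by (auto simp: matricial_spectrahedron_at_def)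
      then have "d = d'" by (auto simp: symmetric_mats_def)
      with Z' show ?thesis by simp
    next
      case True
      then have "Z = []" using Z by (simp add: matricial_spectrahedron_at_def)
      have B0: "linear_pencil 0 m' B" and one: "linear_pencil 0 e (case_nat (1\<^sub>m e) ((!) Z))" for e
        using B by (simp_all add: linear_pencil_def symmetric_mats_def)
      have eval: "psd (pencil_eval_mat n m' B e Z) \<longleftrightarrow>
          (\<forall>U\<in>carrier_mat e m'. 0 \<le> trace_pairing m' (B 0) (transpose_mat U * U))" for e
        using True \<open>Z = []\<close> pencil_eval_mat_eq_tensor_comb[OF B0, of Z e]
          psd_tensor_comb_iff[OF one B0, of e] by simp
      have "0 \<le> quad_form m' (B 0) w" for w
      proof -
        \<comment> \<open>A unit vector in the first factor recovers the form of \<open>B 0\<close>; it exists since \<open>d' \<ge> 1\<close>.\<close>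
        have "quad_form d' (1\<^sub>m d') (\<lambda>p. of_bool (p = 0)) = 1"
          using d' by (simp add: quad_form_def of_bool_def if_distrib[of "\<lambda>x. x * _"]
              if_distrib[of "\<lambda>x. _ * x"] cong: if_cong)
        then show ?thesis
          using Z' trace_pairing_rank_one[OF one_carrier_mat[of d'], of m' "B 0" "\<lambda>p. of_bool (p = 0)" w]
          by (auto simp: matricial_spectrahedron_at_def eval dest: bspec[of _ _ "mat d' m' (\<lambda>(p, a). of_bool (p = 0) * w a)"])
      qed
      then have "psd (pencil_eval_mat n m' B d Z)"
        unfolding eval by (intro ballI) (subst trace_pairing_gram, auto intro: sum_nonneg)
      then show ?thesis using \<open>Z = []\<close> True by (simp add: matricial_spectrahedron_at_def)
    qed
  qed
next
  assume "\<forall>d\<ge>1. matricial_spectrahedron_at n m A d \<subseteq> matricial_spectrahedron_at n m' B d"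
  then show "matricial_spectrahedron n m A \<subseteq> matricial_spectrahedron n m' B"
    unfolding matricial_spectrahedron_def by auto
qed

text \<open>The ampliation replaces \<open>A i\<close> by \<open>B i\<close> in a tensor combination. One direction restricts this to
  tensor combinations with identity as constant coefficient, which are the values of the pencils;
  the other one reduces a general positive semidefinite element to such values through \<open>psd_transfer\<close>.\<close>

lemma (in bounded_pencil) d_positive_iff_inclusion:
  assumes B: "linear_pencil n m' B"
    and lin: "linear_on_mats m (coeff_span n m A) m' (coeff_span n m' B) \<tau>"
    and \<tau>: "\<And>i. i \<le> n \<Longrightarrow> \<tau> (A i) = B i"
  shows "d_positive d m (coeff_span n m A) m' \<tau> \<longleftrightarrow>
    matricial_spectrahedron_at n m A d \<subseteq> matricial_spectrahedron_at n m' B d"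
proof -
  have ampl: "ampliation d m m' \<tau> (tensor_comb n d m X A) = tensor_comb n d m' X B" for X
    using linear_on_mats_lin_comb[OF pencil B lin \<tau> order_refl] by (rule ampliation_tensor_comb)
  show ?thesis
  proof
    assume dpos: "d_positive d m (coeff_span n m A) m' \<tau>"
    show "matricial_spectrahedron_at n m A d \<subseteq> matricial_spectrahedron_at n m' B d"
    proof
      fix Z assume "Z \<in> matricial_spectrahedron_at n m A d"
      then have Z: "length Z = n" "set Z \<subseteq> symmetric_mats d" and psd: "psd (pencil_eval_mat n m A d Z)"
        by (auto simp: matricial_spectrahedron_at_def)
      then have Zc: "set Z \<subseteq> carrier_mat d d" using symmetric_mats_carrier by blast
      have evalA: "pencil_eval_mat n m A d Z = tensor_comb n d m (case_nat (1\<^sub>m d) ((!) Z)) A"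
        using pencil Z(1) Zc by (rule pencil_eval_mat_eq_tensor_comb)
      have evalB: "pencil_eval_mat n m' B d Z = tensor_comb n d m' (case_nat (1\<^sub>m d) ((!) Z)) B"
        using B Z(1) Zc by (rule pencil_eval_mat_eq_tensor_comb)
      have "pencil_eval_mat n m A d Z \<in> block_mats d m (coeff_span n m A)"
        unfolding evalA by (rule tensor_comb_in_block_mats[OF pencil])
      then have "psd (ampliation d m m' \<tau> (pencil_eval_mat n m A d Z))"
        using dpos psd by (simp add: d_positive_def)
      then show "Z \<in> matricial_spectrahedron_at n m' B d"
        using Z by (simp add: matricial_spectrahedron_at_def evalA evalB ampl)
    qed
  next
    assume incl: "matricial_spectrahedron_at n m A d \<subseteq> matricial_spectrahedron_at n m' B d"
    show "d_positive d m (coeff_span n m A) m' \<tau>"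
      unfolding d_positive_def
    proof (intro ballI impI)
      fix Y assume Y: "Y \<in> block_mats d m (coeff_span n m A)" and "psd Y"
      obtain X where Xc: "\<forall>i\<le>n. X i \<in> carrier_mat d d" and YX: "Y = tensor_comb n d m X A"
        using block_mats_imp_tensor_comb[OF pencil Y] by blast
      have "tensor_comb n d m X A \<in> symmetric_mats (d * m)"
        using \<open>psd Y\<close> psd_iff_quad_form[OF tensor_comb_carrier] by (simp add: YX)
      then have X: "linear_pencil n d X" by (rule symmetric_tensor_coeffs[OF Xc])
      show "psd (ampliation d m m' \<tau> Y)"
        unfolding YX ampl using psd_transfer[OF B incl X] \<open>psd Y\<close> by (simp add: YX)
    qed
  qed
qed

theorem theorem4p2p1:
  fixes n m\<^sub>1 m\<^sub>2 :: nat
    and A\<^sub>1 A\<^sub>2 :: "nat \<Rightarrow> real mat"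
    and \<tau> :: "real mat \<Rightarrow> real mat"
  assumes "linear_pencil n m\<^sub>1 A\<^sub>1" and "linear_pencil n m\<^sub>2 A\<^sub>2"
    and "A\<^sub>1 0 \<noteq> 0\<^sub>m m\<^sub>1 m\<^sub>1" and "psd (A\<^sub>1 0)"
    and "bounded_vecs (spectrahedron n m\<^sub>1 A\<^sub>1)"
    and "linear_on_mats m\<^sub>1 (coeff_span n m\<^sub>1 A\<^sub>1) m\<^sub>2 (coeff_span n m\<^sub>2 A\<^sub>2) \<tau>"
    and "\<forall>i \<le> n. \<tau> (A\<^sub>1 i) = A\<^sub>2 i"
  shows "(\<forall>d \<ge> 1. d_positive d m\<^sub>1 (coeff_span n m\<^sub>1 A\<^sub>1) m\<^sub>2 \<tau> \<longleftrightarrow>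
            matricial_spectrahedron_at n m\<^sub>1 A\<^sub>1 d \<subseteq> matricial_spectrahedron_at n m\<^sub>2 A\<^sub>2 d) \<and>
         (completely_positive m\<^sub>1 (coeff_span n m\<^sub>1 A\<^sub>1) m\<^sub>2 \<tau> \<longleftrightarrow>
            matricial_spectrahedron n m\<^sub>1 A\<^sub>1 \<subseteq> matricial_spectrahedron n m\<^sub>2 A\<^sub>2)"
proof -
  interpret bounded_pencil n m\<^sub>1 A\<^sub>1
    by unfold_locales (use assms(1,3,4,5) in auto)
  have each: "d_positive d m\<^sub>1 (coeff_span n m\<^sub>1 A\<^sub>1) m\<^sub>2 \<tau> \<longleftrightarrow>
      matricial_spectrahedron_at n m\<^sub>1 A\<^sub>1 d \<subseteq> matricial_spectrahedron_at n m\<^sub>2 A\<^sub>2 d" for d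
    using assms(2,6,7) by (intro d_positive_iff_inclusion) auto
  then show ?thesis
    unfolding completely_positive_def
    using matricial_spectrahedron_subset_iff[OF assms(2)] by simp
qed

end
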